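(* Let $A$ be an associative algebra, $M$ be an $A$-bimodule and $\{P_x:M\to A\}_{x\in X}$ be a collection of linear maps. Then the triple $(A,M,\{P_x\}_{x\in X})$ is a matching relative Rota-Baxter algebra if and only if the element $P=\oplus_{x\in X}P_x\in\mathfrak g^1$ is a Maurer-Cartan element in the graded Lie algebra $(\oplus_{n\ge 0}\mathfrak g^n,[\![~,~]\!])$.
   Context: $\mathbb K$ is a commutative unital ring with $\mathrm{char}\,\mathbb K\neq 2$. All modules, linear maps, Hom spaces and tensor products are over $\mathbb K$; $X$ is a nonempty set. $a\cdot b$ denotes the product of $A$, and $a\cdot_M u$, $u\cdot_M a$ the left and right actions on the $A$-bimodule $M$. A matching relative Rota-Baxter algebra is a triple $(A,M,\{P_x\}_{x\in X})$ of an associative algebra $A$, an $A$-bimodule $M$ and linear maps $P_x:M\to A$ $(x\in X)$ such that $P_x(u)\cdot P_y(v)=P_x(u\cdot_M P_y(v))+P_y(P_x(u)\cdot_M v)$ for all $u,v\in M$, $x,y\in X$. For $n\ge 1$, $\mathfrak g^n$ is the $\mathbb K$-module of all families $P=\oplus_{x_1,\dots,x_n\in X}P_{x_1,\dots,x_n}$ of linear maps $P_{x_1,\dots,x_n}\in\mathrm{Hom}(M^{\otimes n},A)$ indexed by $X^{\times n}$, and $\mathfrak g^0=A$. For $P\in\mathfrak g^m$, $Q\in\mathfrak g^n$ define $P\diamond Q\in\mathfrak g^{m+n}$ by $$(P\diamond Q)_{x_1,\dots,x_{m+n}}(u_1,\dots,u_{m+n})=\sum_{i=1}^m(-1)^{(i-1)n}P_{x_1,\dots,x_{i-1},x_{i+n},\dots,x_{m+n}}(u_1,\dots,u_{i-1},Q_{x_i,\dots,x_{i+n-1}}(u_i,\dots,u_{i+n-1})\cdot_M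 u_{i+n},\dots,u_{m+n})$$ $$-\sum_{i=1}^m(-1)^{in}P_{x_1,\dots,x_i,x_{i+n+1},\dots,x_{m+n}}(u_1,\dots,u_{i-1},u_i\cdot_M Q_{x_{i+1},\dots,x_{i+n}}(u_{i+1},\dots,u_{i+n}),u_{i+n+1},\dots,u_{m+n})$$ $$+(-1)^{mn}P_{x_1,\dots,x_m}(u_1,\dots,u_m)\cdot Q_{x_{m+1},\dots,x_{m+n}}(u_{m+1},\dots,u_{m+n}).$$ The graded Lie bracket on $\oplus_{n\ge 0}\mathfrak g^n$ is $[\![P,Q]\!]=P\diamond Q-(-1)^{mn}Q\diamond P$. A Maurer-Cartan element of this graded Lie algebra is an element $P\in\mathfrak g^1$ with $[\![P,P]\!]=0$.
   Formalization: The formal theorem also assumes that A has no 2-torsion (2a = 0 implies a = 0); with only char K ≠ 2 the claim fails, e.g. K the integers, A = M = F_2, all P_x the identity. *)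

theory Defs
  imports Complex_Main
begin

(* K, A, M and the index set X are whole types; class ring does not provide a unit. *)
locale assoc_algebra = module sA
  for sA :: "'k::comm_ring_1 \<Rightarrow> 'a::ring \<Rightarrow> 'a" +
  assumes mult_scale_left: "sA k a * b = sA k (a * b)"
    and mult_scale_right: "a * sA k b = sA k (a * b)"

locale algebra_bimodule = A: assoc_algebra sA + M: module sM
  for sA :: "'k::comm_ring_1 \<Rightarrow> 'a::ring \<Rightarrow> 'a"
    and sM :: "'k \<Rightarrow> 'm::ab_group_add \<Rightarrow> 'm" +
  fixes lact :: "'a \<Rightarrow> 'm \<Rightarrow> 'm"
    and ract :: "'m \<Rightarrow> 'a \<Rightarrow> 'm"
  assumes lact_hom_left: "module_hom sA sM (\<lambda>a. lact a u)"
    and lact_hom_right: "module_hom sM sM (\<lambda>u. lact a u)"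
    and ract_hom_left: "module_hom sM sM (\<lambda>u. ract u a)"
    and ract_hom_right: "module_hom sA sM (\<lambda>a. ract u a)"
    and lact_lact: "lact (a * b) u = lact a (lact b u)"
    and ract_ract: "ract u (a * b) = ract (ract u a) b"
    and lact_ract: "ract (lact a u) b = lact a (ract u b)"

locale matching_rel_Rota_Baxter_algebra = algebra_bimodule sA sM lact ract
  for sA :: "'k::comm_ring_1 \<Rightarrow> 'a::ring \<Rightarrow> 'a"
    and sM :: "'k \<Rightarrow> 'm::ab_group_add \<Rightarrow> 'm"
    and lact :: "'a \<Rightarrow> 'm \<Rightarrow> 'm"
    and ract :: "'m \<Rightarrow> 'a \<Rightarrow> 'm" +
  fixes P :: "'x \<Rightarrow> 'm \<Rightarrow> 'a"
  assumes P_linear: "module_hom sM sA (P x)"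
    and matching_Rota_Baxter:
      "P x u * P y v = P x (ract u (P y v)) + P y (lact (P x u) v)"

(* The value of P_{x_1,...,x_n} at u_1 \<otimes> ... \<otimes> u_n is written
   P [x_1,...,x_n] [u_1,...,u_n]. *)
type_synonym ('x, 'm, 'a) family = "'x list \<Rightarrow> 'm list \<Rightarrow> 'a"

(* The module g^n. By the universal property of the tensor product, Hom(M^{\<otimes>n}, A) is
   the module of n-linear maps; in degree 0 there is a single value P [] [], so g^0 = A.
   Values at lists of a length other than n are fixed to be 0, so that equality of
   families is equality of functions. *)
definition cochains ::
  "('k::comm_ring_1 \<Rightarrow> 'a::ring \<Rightarrow> 'a) \<Rightarrow> ('k \<Rightarrow> 'm::ab_group_add \<Rightarrow> 'm) \<Rightarrow> nat
    \<Rightarrow> ('x, 'm, 'a) family set" where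
  "cochains sA sM n = {P.
     (\<forall>xs us. length xs \<noteq> n \<or> length us \<noteq> n \<longrightarrow> P xs us = 0) \<and>
     (\<forall>xs us i. length xs = n \<and> length us = n \<and> i < n \<longrightarrow>
        module_hom sM sA (\<lambda>u. P xs (us[i := u])))}"

(* P \<diamondop> Q for P of degree m and Q of degree n. Lists are indexed from 0: x_j is
   xs ! (j - 1), and take n (drop j xs) is x_{j+1},...,x_{j+n}. *)
definition diamond ::
  "('k::comm_ring_1 \<Rightarrow> 'a::ring \<Rightarrow> 'a) \<Rightarrow> ('a \<Rightarrow> 'm \<Rightarrow> 'm) \<Rightarrow> ('m \<Rightarrow> 'a \<Rightarrow> 'm) \<Rightarrow> nat \<Rightarrow> nat
    \<Rightarrow> ('x, 'm, 'a) family \<Rightarrow> ('x, 'm, 'a) family \<Rightarrow> ('x, 'm, 'a) family" where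
  "diamond sA lact ract m n P Q = (\<lambda>xs us.
     if length xs = m + n \<and> length us = m + n then
       (\<Sum>i = 1..m. sA ((-1) ^ ((i - 1) * n))
          (P (take (i - 1) xs @ drop (i + n - 1) xs)
             (take (i - 1) us
                @ [lact (Q (take n (drop (i - 1) xs)) (take n (drop (i - 1) us)))
                        (us ! (i + n - 1))]
                @ drop (i + n) us)))
       - (\<Sum>i = 1..m. sA ((-1) ^ (i * n))
          (P (take i xs @ drop (i + n) xs)
             (take (i - 1) us
                @ [ract (us ! (i - 1)) (Q (take n (drop i xs)) (take n (drop i us)))]
                @ drop (i + n) us)))
       + sA ((-1) ^ (m * n)) (P (take m xs) (take m us) * Q (drop m xs) (drop m us))
     else 0)"

definition gbracket ::
  "('k::comm_ring_1 \<Rightarrow> 'a::ring \<Rightarrow> 'a) \<Rightarrow> ('a \<Rightarrow> 'm \<Rightarrow> 'm) \<Rightarrow> ('m \<Rightarrow> 'a \<Rightarrow> 'm) \<Rightarrow> nat \<Rightarrow> nat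
    \<Rightarrow> ('x, 'm, 'a) family \<Rightarrow> ('x, 'm, 'a) family \<Rightarrow> ('x, 'm, 'a) family" where
  "gbracket sA lact ract m n P Q = (\<lambda>xs us.
     diamond sA lact ract m n P Q xs us
     - sA ((-1) ^ (m * n)) (diamond sA lact ract n m Q P xs us))"

definition maurer_cartan ::
  "('k::comm_ring_1 \<Rightarrow> 'a::ring \<Rightarrow> 'a) \<Rightarrow> ('k \<Rightarrow> 'm::ab_group_add \<Rightarrow> 'm)
    \<Rightarrow> ('a \<Rightarrow> 'm \<Rightarrow> 'm) \<Rightarrow> ('m \<Rightarrow> 'a \<Rightarrow> 'm) \<Rightarrow> ('x, 'm, 'a) family \<Rightarrow> bool" where
  "maurer_cartan sA sM lact ract P \<longleftrightarrow>
     P \<in> cochains sA sM 1 \<and> gbracket sA lact ract 1 1 P P = (\<lambda>xs us. 0)"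

(* The element of g^1 given by a collection (P_x) of maps M \<rightarrow> A. *)
definition family_of :: "('x \<Rightarrow> 'm \<Rightarrow> 'a::zero) \<Rightarrow> ('x, 'm, 'a) family" where
  "family_of P = (\<lambda>xs us. if length xs = 1 \<and> length us = 1 then P (hd xs) (hd us) else 0)"

(* The hypothesis "no 2-torsion" on A, which the equivalence needs besides char K \<noteq> 2
   (counterexample without it: K the integers, A = M = F_2, all P_x the identity),
   holds whenever 2 is invertible in K, e.g. if K is a field of characteristic not 2. *)
lemma no_two_torsion_if_two_unit:
  fixes s :: "'k::comm_ring_1 \<Rightarrow> 'b::ab_group_add \<Rightarrow> 'b"
  assumes "module s" and "(2::'k) dvd 1" and "s 2 a = 0"
  shows "a = 0"
proof -
  interpret module s by fact
  from assms(2) obtain h :: 'k where h: "1 = 2 * h" by (auto simp: dvd_def)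
  have "a = s (h * 2) a" using h by (simp add: mult.commute)
  also have "\<dots> = s h (s 2 a)" by simp
  finally show ?thesis using assms(3) by simp
qed

end

theory Submission
  imports Defs
begin

text \<open>
  In degree 1 every sum in the product \<open>P \<diamondop> P\<close> has a single summand, and the product is the
  defect of the matching Rota-Baxter identity,
  \<open>P\<^sub>y (P\<^sub>x u \<cdot> v) + P\<^sub>x (u \<cdot> P\<^sub>y v) - P\<^sub>x u \<cdot> P\<^sub>y v\<close> (\<open>diamond_family_of\<close>).  The degree is odd, so the
  graded commutator adds the two copies of this defect instead of cancelling them: the bracket of
  \<open>P\<close> with itself is twice the defect (\<open>gbracket_odd_self\<close>).  Since \<open>A\<close> has no 2-torsion, the
  bracket vanishes exactly when the defect does.  The other part of the Maurer-Cartan condition,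
  membership in degree 1, is the linearity of the \<open>P\<^sub>x\<close>.
\<close>

lemma family_of_in_cochains:
  assumes "\<And>x. module_hom sM sA (P x)"
  shows "family_of P \<in> cochains sA sM 1"
proof -
  have "(\<lambda>u. family_of P xs (us[i := u])) = P (hd xs)"
    if "length xs = 1" "length us = 1" "i < 1" for xs us i
    using that by (cases us) (auto simp: family_of_def)
  then show ?thesis
    using assms by (auto simp: cochains_def family_of_def)
qed

context algebra_bimodule
begin

lemma diamond_family_of:
  "diamond sA lact ract 1 1 (family_of P) (family_of P) [x, y] [u, v] =
     P y (lact (P x u) v) + P x (ract u (P y v)) - P x u * P y v"
  by (simp add: diamond_def family_of_def)

lemma diamond_eq_zero_iff:
  "diamond sA lact ract 1 1 Q R = (\<lambda>xs us. 0) \<longleftrightarrow>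
     (\<forall>x y u v. diamond sA lact ract 1 1 Q R [x, y] [u, v] = 0)"
proof
  assume zero: "\<forall>x y u v. diamond sA lact ract 1 1 Q R [x, y] [u, v] = 0"
  have "diamond sA lact ract 1 1 Q R xs us = 0" for xs us
  proof (cases "length xs = 2 \<and> length us = 2")
    case True
    then obtain x y u v where "xs = [x, y]" "us = [u, v]"
      by (auto simp: numeral_2_eq_2 length_Suc_conv)
    with zero show ?thesis by blast
  next
    case False
    then show ?thesis by (auto simp: diamond_def)
  qed
  then show "diamond sA lact ract 1 1 Q R = (\<lambda>xs us. 0)" by blast
qed simp

lemma gbracket_odd_self:
  assumes "odd n"
  shows "gbracket sA lact ract n n Q Q xs us = sA 2 (diamond sA lact ract n n Q Q xs us)"
proof -
  have "sA 2 d = d + d" for d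
    using A.scale_left_distrib[of 1 1 d] by simp
  with assms show ?thesis by (simp add: gbracket_def)
qed

end

theorem theorem4p2:
  fixes sA :: "'k::comm_ring_1 \<Rightarrow> 'a::ring \<Rightarrow> 'a"
    and sM :: "'k \<Rightarrow> 'm::ab_group_add \<Rightarrow> 'm"
    and lact :: "'a \<Rightarrow> 'm \<Rightarrow> 'm"
    and ract :: "'m \<Rightarrow> 'a \<Rightarrow> 'm"
    and P :: "'x \<Rightarrow> 'm \<Rightarrow> 'a"
  assumes char_K: "CHAR('k) \<noteq> 2"
    and no_two_torsion: "\<And>a. sA 2 a = 0 \<Longrightarrow> a = 0"
    and bimodule: "algebra_bimodule sA sM lact ract"
    and linear: "\<And>x. module_hom sM sA (P x)"
  shows "matching_rel_Rota_Baxter_algebra sA sM lact ract P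
    \<longleftrightarrow> maurer_cartan sA sM lact ract (family_of P)"
proof -
  interpret algebra_bimodule sA sM lact ract by (fact bimodule)
  let ?D = "diamond sA lact ract 1 1 (family_of P) (family_of P)"
  have two_iff: "sA 2 a = 0 \<longleftrightarrow> a = 0" for a
    using no_two_torsion by auto
  have "maurer_cartan sA sM lact ract (family_of P) \<longleftrightarrow> ?D = (\<lambda>xs us. 0)"
    using family_of_in_cochains[of sM sA P] linear
    by (simp add: maurer_cartan_def fun_eq_iff gbracket_odd_self two_iff)
  also have "\<dots> \<longleftrightarrow> (\<forall>x y u v. P x u * P y v = P x (ract u (P y v)) + P y (lact (P x u) v))"
    unfolding diamond_eq_zero_iff diamond_family_of by (auto simp: algebra_simps)
  also have "\<dots> \<longleftrightarrow> matching_rel_Rota_Baxter_algebra sA sM lact ract P"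
    using bimodule linear
    by (auto simp: matching_rel_Rota_Baxter_algebra_def
        matching_rel_Rota_Baxter_algebra_axioms_def)
  finally show ?thesis by simp
qed

end
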